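(* Let $N\ge2$ and let $\mathcal{K}\subset\mathbb{R}^N$ be a convex body. For $\omega\in\mathbb{S}^{N-1}$ consider the function $f_\omega:\mathcal{S}_\omega(\mathcal{K})\to\mathbb{R}$ given by $$ f_\omega(y)=\frac{a_\omega(y)+b_\omega(y)}{2},\qquad y\in\mathcal{S}_\omega(\mathcal{K}). $$ Then $$ \mathcal{R}_{\mathcal{K}}(\omega)=\max_{y\in\mathcal{S}_\omega(\mathcal{K})}f_\omega(y). $$
   Context: A convex body is a compact convex set with non-empty interior. For $\omega\in\mathbb{S}^{N-1}$ (the unit sphere) and $\lambda\in\mathbb{R}$: $\mathcal{K}^+_{\lambda,\omega}=\{x\in\mathcal{K}: x\cdot\omega>\lambda\}$, and $\mathcal{T}_{\lambda,\omega}(x)=x-2(x\cdot\omega)\omega+2\lambda\omega$ is the reflection with respect to the hyperplane $\{x\cdot\omega=\lambda\}$. The maximal folding function of $\mathcal{K}$ is $\mathcal{R}_{\mathcal{K}}(\omega)=\min\{\lambda\in\mathbb{R}:\ \mathcal{T}_{\lambda,\omega}(\mathcal{K}^+_{\lambda,\omega})\subseteq\mathcal{K}\}$. Let $\omega^\perp=\{x: x\cdot\omega=0\}$ and $\mathcal{P}_\omega(x)=x-(x\cdot\omega)\omega$. The shadow of $\mathcal{K}$ in the direction $\omega$ is $\mathcal{S}_\omega(\mathcal{K})=\mathcal{P}_\omega(\mathcal{K})\subset\omega^\perp$, and for $y\in\mathcal{S}_\omega(\mathcal{K})$, $a_\omega(y)=\min\{t\in\mathbb{R}: y+t\omega\in\mathcal{K}\}$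 and $b_\omega(y)=\max\{t\in\mathbb{R}: y+t\omega\in\mathcal{K}\}$.
   Formalization: For N≥3 the maximum of f_ω over the shadow need not exist (f_ω can approach its supremum at a boundary point of the shadow without attaining it), so the maximum is replaced by the supremum, with f_ω shown bounded above; attainment is proved for N=2 only. *)

theory Defs
  imports "HOL-Analysis.Analysis"
begin

definition convex_body :: "(real ^ 'n) set \<Rightarrow> bool" where
  "convex_body K \<longleftrightarrow> compact K \<and> convex K \<and> interior K \<noteq> {}"

definition cap :: "(real ^ 'n) set \<Rightarrow> real \<Rightarrow> real ^ 'n \<Rightarrow> (real ^ 'n) set" where
  "cap K l w = {x \<in> K. x \<bullet> w > l}"

definition reflection :: "real \<Rightarrow> real ^ 'n \<Rightarrow> real ^ 'n \<Rightarrow> real ^ 'n" where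
  "reflection l w x = x - (2 * (x \<bullet> w)) *\<^sub>R w + (2 * l) *\<^sub>R w"

(* The minima and maxima of sets of reals below are written with LEAST and GREATEST. They are
   attained for a compact nonempty K, a unit vector w and y in the shadow. *)

definition max_folding :: "(real ^ 'n) set \<Rightarrow> real ^ 'n \<Rightarrow> real" where
  "max_folding K w = (LEAST l. reflection l w ` cap K l w \<subseteq> K)"

definition proj_perp :: "real ^ 'n \<Rightarrow> real ^ 'n \<Rightarrow> real ^ 'n" where
  "proj_perp w x = x - (x \<bullet> w) *\<^sub>R w"

definition shadow :: "real ^ 'n \<Rightarrow> (real ^ 'n) set \<Rightarrow> (real ^ 'n) set" where
  "shadow w K = proj_perp w ` K"

definition lower_end :: "(real ^ 'n) set \<Rightarrow> real ^ 'n \<Rightarrow> real ^ 'n \<Rightarrow> real" where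
  "lower_end K w y = (LEAST t. y + t *\<^sub>R w \<in> K)"

definition upper_end :: "(real ^ 'n) set \<Rightarrow> real ^ 'n \<Rightarrow> real ^ 'n \<Rightarrow> real" where
  "upper_end K w y = (GREATEST t. y + t *\<^sub>R w \<in> K)"

(* In dimension at least 3 this function need not attain its supremum on the shadow, because
   lower_end and upper_end can jump at the relative boundary of the shadow. In dimension 3 take
     K = {(u, v, z). 0 <= u, 0 <= z <= 2, v^2 <= u z, u^2 + v^2 <= 2 u},  w = (0, 0, 1).
   Then upper_end is 2 on the shadow, while lower_end at (u, v, 0) is v^2 / u <= 2 - u < 2 for
   u > 0, and 0 at the origin. The supremum of midpoint_fun is 2, approached along
   u^2 + v^2 = 2 u as u tends to 0, and it is not attained. A product of K with a cube gives the
   same in higher dimensions. A statement about the "maximum" of midpoint_fun is therefore to be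
   read as one about its supremum, except in the plane, where the maximum exists. *)

definition midpoint_fun :: "(real ^ 'n) set \<Rightarrow> real ^ 'n \<Rightarrow> real ^ 'n \<Rightarrow> real" where
  "midpoint_fun K w y = (lower_end K w y + upper_end K w y) / 2"

end

theory Submission
  imports Defs
begin

text \<open>
  Cut \<open>K\<close> into its chords parallel to \<open>w\<close>. The chord over a point \<open>y\<close> of the shadow is
  \<open>{y + t w | a \<le> t \<le> b}\<close> with \<open>a = lower_end K w y\<close> and \<open>b = upper_end K w y\<close>, and the reflection
  at level \<open>l\<close> maps each line parallel to \<open>w\<close> to itself by \<open>t \<mapsto> 2 l - t\<close>. Folding a chord that
  crosses level \<open>l\<close> moves its top to height \<open>2 l - b\<close>, and the folded piece stays in the chord
  exactly if \<open>2 l - b \<ge> a\<close>, that is, if \<open>l\<close> is at least the height of the midpoint. A chord below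
  level \<open>l\<close> is not folded and satisfies that inequality anyway. So the admissible levels are
  precisely the upper bounds of \<open>midpoint_fun K w\<close> on the shadow (\<open>folds_into_iff\<close>), and the least
  of them is its supremum.

  In the plane the shadow is a segment, and the supremum is attained because the midpoint function
  is upper semicontinuous there. For the upper ends this follows from the closedness of \<open>K\<close>. The
  lower end is a convex function (\<open>convex_on_lower_end\<close>), and a convex function on a segment grows
  at most linearly away from any given point, even from an end of the segment
  (\<open>convex_on_segment_linear_growth\<close>); this last property fails for general convex shadows of
  higher dimension.
\<close>

section \<open>Chords in a fixed direction\<close>

lemma inner_proj_perp:
  fixes w :: "real ^ 'n"
  assumes "norm w = 1"
  shows "proj_perp w x \<bullet> w = 0"
  using assms by (simp add: proj_perp_def inner_diff_left dot_square_norm)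

lemma shadow_orthogonal:
  fixes w :: "real ^ 'n"
  assumes "norm w = 1" "y \<in> shadow w K"
  shows "y \<bullet> w = 0"
  using assms inner_proj_perp by (auto simp: shadow_def)

lemma proj_perp_decompose: "proj_perp w x + (x \<bullet> w) *\<^sub>R w = x"
  by (simp add: proj_perp_def)

lemma proj_perp_chord:
  fixes w :: "real ^ 'n"
  assumes "norm w = 1" "y \<bullet> w = 0"
  shows "proj_perp w (y + t *\<^sub>R w) = y"
  using assms by (simp add: proj_perp_def inner_add_left dot_square_norm)

lemma chord_height:
  fixes w :: "real ^ 'n"
  assumes "norm w = 1" "y \<bullet> w = 0"
  shows "(y + t *\<^sub>R w) \<bullet> w = t"
  using assms by (simp add: inner_add_left dot_square_norm)

lemma reflection_on_chord:
  "reflection l w x = proj_perp w x + (2 * l - x \<bullet> w) *\<^sub>R w"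
  by (simp add: reflection_def proj_perp_def scaleR_diff_left scaleR_2 flip: scaleR_scaleR)

context
  fixes K :: "(real ^ 'n) set" and w :: "real ^ 'n"
  assumes compact_K: "compact K" and convex_K: "convex K" and norm_w: "norm w = 1"
begin

lemma compact_chord_parameters: "compact {t. y + t *\<^sub>R w \<in> K}"
proof -
  obtain B where B: "\<And>x. x \<in> K \<Longrightarrow> norm x \<le> B"
    using compact_imp_bounded[OF compact_K] by (auto simp: bounded_iff)
  have "\<bar>t\<bar> \<le> B + norm y" if "y + t *\<^sub>R w \<in> K" for t
    using B[OF that] norm_w norm_triangle_ineq4[of "y + t *\<^sub>R w" y] by simp
  then have "bounded {t. y + t *\<^sub>R w \<in> K}"
    by (auto simp: bounded_iff)
  moreover have "closed ((\<lambda>t. y + t *\<^sub>R w) -` K)"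
    by (intro closed_vimage compact_imp_closed[OF compact_K] continuous_intros)
  ultimately show ?thesis
    by (simp add: compact_eq_bounded_closed vimage_def)
qed

lemma chord_iff:
  assumes y: "y \<in> shadow w K"
  shows "y + t *\<^sub>R w \<in> K \<longleftrightarrow> lower_end K w y \<le> t \<and> t \<le> upper_end K w y"
    and "lower_end K w y \<le> upper_end K w y"
proof -
  let ?T = "{t. y + t *\<^sub>R w \<in> K}"
  obtain x where "x \<in> K" "y = proj_perp w x"
    using y by (auto simp: shadow_def)
  then have ne: "?T \<noteq> {}"
    using proj_perp_decompose[of w x] by (metis (mono_tags) empty_iff mem_Collect_eq)
  obtain a where a: "a \<in> ?T" "\<forall>t\<in>?T. a \<le> t"
    using compact_attains_inf[OF compact_chord_parameters ne] by auto
  obtain b where b: "b \<in> ?T" "\<forall>t\<in>?T. t \<le> b"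
    using compact_attains_sup[OF compact_chord_parameters ne] by auto
  have low: "lower_end K w y = a"
    unfolding lower_end_def using a by (intro Least_equality) auto
  have up: "upper_end K w y = b"
    unfolding upper_end_def using b by (intro Greatest_equality) auto
  have "a \<le> b"
    using a b by auto
  have "y + t *\<^sub>R w \<in> K" if t: "a \<le> t" "t \<le> b" for t
  proof -
    have "t \<in> closed_segment a b"
      using t by (simp add: closed_segment_eq_real_ivl)
    then obtain u where u: "0 \<le> u" "u \<le> 1" "t = (1 - u) * a + u * b"
      by (auto simp: in_segment)
    have "(1 - u) *\<^sub>R (y + a *\<^sub>R w) + u *\<^sub>R (y + b *\<^sub>R w) \<in> K"
      using a b u by (intro convexD_alt[OF convex_K]) auto
    also have "(1 - u) *\<^sub>R (y + a *\<^sub>R w) + u *\<^sub>R (y + b *\<^sub>R w) = y + t *\<^sub>R w"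
      unfolding u(3) by (simp add: algebra_simps)
    finally show ?thesis .
  qed
  then show "y + t *\<^sub>R w \<in> K \<longleftrightarrow> lower_end K w y \<le> t \<and> t \<le> upper_end K w y"
    unfolding low up using a(2) b(2) by blast
  show "lower_end K w y \<le> upper_end K w y"
    using \<open>a \<le> b\<close> low up by simp
qed

lemma lower_end_in: "y \<in> shadow w K \<Longrightarrow> y + lower_end K w y *\<^sub>R w \<in> K"
  and upper_end_in: "y \<in> shadow w K \<Longrightarrow> y + upper_end K w y *\<^sub>R w \<in> K"
  by (simp_all add: chord_iff)

lemma height_between_ends:
  assumes "x \<in> K"
  shows "lower_end K w (proj_perp w x) \<le> x \<bullet> w" "x \<bullet> w \<le> upper_end K w (proj_perp w x)"
proof -
  have "proj_perp w x \<in> shadow w K"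
    using assms by (simp add: shadow_def)
  moreover have "proj_perp w x + (x \<bullet> w) *\<^sub>R w \<in> K"
    using assms by (simp add: proj_perp_decompose)
  ultimately show "lower_end K w (proj_perp w x) \<le> x \<bullet> w" "x \<bullet> w \<le> upper_end K w (proj_perp w x)"
    using chord_iff(1) by blast+
qed

section \<open>Foldings and midpoints\<close>

lemma folds_into_iff:
  "reflection l w ` cap K l w \<subseteq> K \<longleftrightarrow> (\<forall>y\<in>shadow w K. midpoint_fun K w y \<le> l)"
proof
  assume fold: "reflection l w ` cap K l w \<subseteq> K"
  show "\<forall>y\<in>shadow w K. midpoint_fun K w y \<le> l"
  proof
    fix y assume y: "y \<in> shadow w K"
    let ?a = "lower_end K w y" and ?b = "upper_end K w y"
    let ?x = "y + ?b *\<^sub>R w"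
    have yw: "y \<bullet> w = 0"
      using shadow_orthogonal[OF norm_w y] .
    have "?a + ?b \<le> 2 * l"
    proof (cases "l < ?b")
      case True
      then have "?x \<in> cap K l w"
        by (simp add: cap_def upper_end_in[OF y] chord_height[OF norm_w yw])
      then have "reflection l w ?x \<in> K"
        using fold by auto
      then have "y + (2 * l - ?b) *\<^sub>R w \<in> K"
        by (simp add: reflection_on_chord proj_perp_chord[OF norm_w yw] chord_height[OF norm_w yw])
      then show ?thesis
        using chord_iff(1)[OF y] by auto
    next
      case False
      then show ?thesis
        using chord_iff(2)[OF y] by simp
    qed
    then show "midpoint_fun K w y \<le> l"
      by (simp add: midpoint_fun_def)
  qed
next
  assume mid: "\<forall>y\<in>shadow w K. midpoint_fun K w y \<le> l"
  have "reflection l w x \<in> K" if "x \<in> K" "l < x \<bullet> w" for x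
  proof -
    let ?y = "proj_perp w x"
    have y: "?y \<in> shadow w K"
      using that by (simp add: shadow_def)
    have "lower_end K w ?y + upper_end K w ?y \<le> 2 * l"
      using bspec[OF mid y] by (simp add: midpoint_fun_def)
    then have "?y + (2 * l - x \<bullet> w) *\<^sub>R w \<in> K"
      using height_between_ends[OF that(1)] that(2) by (simp add: chord_iff(1)[OF y])
    then show ?thesis
      by (simp add: reflection_on_chord)
  qed
  then show "reflection l w ` cap K l w \<subseteq> K"
    by (auto simp: cap_def)
qed

lemma bdd_above_midpoint_fun: "bdd_above (midpoint_fun K w ` shadow w K)"
proof -
  obtain B where B: "\<And>x. x \<in> K \<Longrightarrow> norm x \<le> B"
    using compact_imp_bounded[OF compact_K] by (auto simp: bounded_iff)
  have "midpoint_fun K w y \<le> B" if y: "y \<in> shadow w K" for y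
  proof -
    let ?x = "y + upper_end K w y *\<^sub>R w"
    have "midpoint_fun K w y \<le> upper_end K w y"
      using chord_iff(2)[OF y] by (simp add: midpoint_fun_def)
    also have "\<dots> = ?x \<bullet> w"
      by (simp add: chord_height[OF norm_w shadow_orthogonal[OF norm_w y]])
    also have "\<dots> \<le> norm ?x"
      using norm_cauchy_schwarz[of ?x w] norm_w by simp
    also have "\<dots> \<le> B"
      using B upper_end_in[OF y] by blast
    finally show ?thesis .
  qed
  then show ?thesis
    by (auto simp: bdd_above_def)
qed

lemma max_folding_eq_SUP:
  assumes "K \<noteq> {}"
  shows "max_folding K w = (SUP y\<in>shadow w K. midpoint_fun K w y)"
proof -
  have ne: "shadow w K \<noteq> {}"
    using assms by (simp add: shadow_def)
  show ?thesis
    unfolding max_folding_def folds_into_iff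
    by (rule Least_equality) (auto intro: cSUP_upper cSUP_least bdd_above_midpoint_fun simp: ne)
qed

section \<open>Attainment over a segment\<close>

lemma convex_shadow: "convex (shadow w K)"
  and compact_shadow: "compact (shadow w K)"
proof -
  have lin: "linear (proj_perp w)"
    by (rule linearI) (simp_all add: proj_perp_def algebra_simps inner_add_left)
  show "convex (shadow w K)"
    unfolding shadow_def by (rule convex_linear_image[OF lin convex_K])
  show "compact (shadow w K)"
    unfolding shadow_def
    by (rule compact_continuous_image[OF linear_continuous_on compact_K])
      (simp add: lin linear_conv_bounded_linear[symmetric])
qed

text \<open>
  The epigraph of the lower end is swept out by moving the convex set \<open>K\<close> upwards along \<open>w\<close>.
\<close>

lemma convex_on_lower_end: "convex_on (shadow w K) (lower_end K w)"
proof (rule convex_onI)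
  fix t :: real and x y
  assume t: "0 < t" "t < 1" and xy: "x \<in> shadow w K" "y \<in> shadow w K"
  let ?z = "(1 - t) *\<^sub>R x + t *\<^sub>R y"
  have z: "?z \<in> shadow w K"
    using convexD_alt[OF convex_shadow xy] t by simp
  have "(1 - t) *\<^sub>R (x + lower_end K w x *\<^sub>R w) + t *\<^sub>R (y + lower_end K w y *\<^sub>R w) \<in> K"
    using t by (intro convexD_alt[OF convex_K] lower_end_in xy) auto
  also have "(1 - t) *\<^sub>R (x + lower_end K w x *\<^sub>R w) + t *\<^sub>R (y + lower_end K w y *\<^sub>R w)
      = ?z + ((1 - t) * lower_end K w x + t * lower_end K w y) *\<^sub>R w"
    by (simp add: algebra_simps)
  finally show "lower_end K w ?z \<le> (1 - t) * lower_end K w x + t * lower_end K w y"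
    by (simp add: chord_iff(1)[OF z])
qed (rule convex_shadow)

end

text \<open>
  Between \<open>y0\<close> and an end \<open>z\<close> of the segment the function lies below its chord, whose slope is
  determined by \<open>y0\<close> and \<open>z\<close>. Only two ends have to be considered, which is what makes the bound
  uniform.
\<close>

lemma convex_on_segment_linear_growth:
  fixes g :: "'a::euclidean_space \<Rightarrow> real"
  assumes g: "convex_on (closed_segment c d) g" and y0: "y0 \<in> closed_segment c d"
  shows "\<exists>C. \<forall>y\<in>closed_segment c d. g y \<le> g y0 + C * norm (y - y0)"
proof -
  define C where "C z = \<bar>g z - g y0\<bar> / norm (z - y0)" for z
  have towards_end: "g y \<le> g y0 + C z * norm (y - y0)"
    if z: "z \<in> closed_segment c d" and y: "y \<in> closed_segment y0 z" for y z
  proof (cases "z = y0")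
    case True
    then show ?thesis
      using y by simp
  next
    case False
    obtain s where s: "0 \<le> s" "s \<le> 1" "y = (1 - s) *\<^sub>R y0 + s *\<^sub>R z"
      using y by (auto simp: in_segment)
    have "g y \<le> (1 - s) * g y0 + s * g z"
      using convex_onD[OF g s(1,2) y0 z] s(3) by simp
    also have "\<dots> = g y0 + s * (g z - g y0)"
      by (simp add: algebra_simps)
    also have "\<dots> \<le> g y0 + s * \<bar>g z - g y0\<bar>"
      using s(1) by (simp add: mult_left_mono)
    also have "\<dots> = g y0 + C z * norm (y - y0)"
    proof -
      have "y - y0 = s *\<^sub>R (z - y0)"
        using s(3) by (simp add: algebra_simps)
      then have "norm (y - y0) = s * norm (z - y0)"
        using s(1) by simp
      then show ?thesis
        using False by (simp add: C_def)
    qed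
    finally show ?thesis .
  qed
  have pos: "0 \<le> C z * norm (y - y0)" for z y
    by (simp add: C_def)
  have "g y \<le> g y0 + (C c + C d) * norm (y - y0)" if "y \<in> closed_segment c d" for y
  proof -
    have "y \<in> closed_segment y0 c \<or> y \<in> closed_segment y0 d"
      using that Un_closed_segment[OF y0] by (auto simp: closed_segment_commute)
    then show ?thesis
      using towards_end[of c y] towards_end[of d y] pos[of c y] pos[of d y]
      by (auto simp: distrib_right)
  qed
  then show ?thesis
    by blast
qed

text \<open>
  Along a maximizing sequence of the midpoint function both ends of the chords converge in \<open>K\<close>.
  The limit of the upper ends is at most the upper end of the limit chord, as \<open>K\<close> is closed. The
  limit of the lower ends must not exceed the lower end of the limit chord; this is the inequality
  that needs the shadow to be a segment.
\<close>

lemma midpoint_fun_attains_SUP: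
  fixes K :: "(real ^ 'n) set" and w :: "real ^ 'n"
  assumes "compact K" "convex K" "norm w = 1" "K \<noteq> {}" "shadow w K = closed_segment c d"
  shows "\<exists>y\<in>shadow w K. midpoint_fun K w y = (SUP y\<in>shadow w K. midpoint_fun K w y)"
proof -
  let ?S = "shadow w K" and ?f = "midpoint_fun K w"
  define M where "M = (SUP y\<in>?S. ?f y)"
  have ne: "?S \<noteq> {}"
    using assms by (simp add: shadow_def)
  have bdd: "bdd_above (?f ` ?S)"
    by (rule bdd_above_midpoint_fun[OF assms(1-3)])
  have "M \<in> closure (?f ` ?S)"
    unfolding M_def using ne bdd by (intro closure_contains_Sup) auto
  then obtain h where h: "\<And>n. h n \<in> ?f ` ?S" "h \<longlonglongrightarrow> M"
    by (auto simp: closure_sequential)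
  then have "\<forall>n. \<exists>z. z \<in> ?S \<and> h n = ?f z"
    by (simp add: image_iff Bex_def)
  then obtain y where "\<forall>n. y n \<in> ?S \<and> h n = ?f (y n)"
    by (rule choice[THEN exE])
  then have y: "\<And>n. y n \<in> ?S" and hy: "\<And>n. h n = ?f (y n)"
    by simp_all
  then have lim_f: "(\<lambda>n. ?f (y n)) \<longlonglongrightarrow> M"
    using h(2) by (simp add: hy[symmetric])
  define p where "p n = y n + lower_end K w (y n) *\<^sub>R w" for n
  define q where "q n = y n + upper_end K w (y n) *\<^sub>R w" for n
  have yw: "y n \<bullet> w = 0" for n
    using shadow_orthogonal[OF assms(3) y] .
  have pq: "p n \<in> K" "q n \<in> K" for n
    unfolding p_def q_def by (simp_all add: lower_end_in[OF assms(1-3) y] upper_end_in[OF assms(1-3) y])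
  have "seq_compact (K \<times> K)"
    using assms(1) by (intro compact_imp_seq_compact compact_Times)
  moreover have "\<forall>n. (p n, q n) \<in> K \<times> K"
    using pq by simp
  ultimately obtain pq' r where r: "pq' \<in> K \<times> K" "strict_mono (r :: nat \<Rightarrow> nat)"
      "((\<lambda>n. (p n, q n)) \<circ> r) \<longlonglongrightarrow> pq'"
    by (rule seq_compactE)
  then obtain p0 q0 where "pq' = (p0, q0)" "p0 \<in> K" "q0 \<in> K"
    by auto
  with r have lim_p: "(\<lambda>n. p (r n)) \<longlonglongrightarrow> p0" and lim_q: "(\<lambda>n. q (r n)) \<longlonglongrightarrow> q0"
    using tendsto_fst[of "(\<lambda>n. (p n, q n)) \<circ> r" pq'] tendsto_snd[of "(\<lambda>n. (p n, q n)) \<circ> r" pq']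
    by (simp_all add: o_def)
  let ?y0 = "proj_perp w q0"
  have y0: "?y0 \<in> ?S"
    using \<open>q0 \<in> K\<close> by (simp add: shadow_def)
  have "(\<lambda>n. proj_perp w (q (r n))) \<longlonglongrightarrow> ?y0"
    unfolding proj_perp_def by (intro tendsto_intros lim_q)
  then have lim_y: "(\<lambda>n. y (r n)) \<longlonglongrightarrow> ?y0"
    by (simp add: q_def proj_perp_chord[OF assms(3) yw])
  have "(\<lambda>n. p (r n) \<bullet> w) \<longlonglongrightarrow> p0 \<bullet> w"
    by (intro tendsto_intros lim_p)
  then have lim_low: "(\<lambda>n. lower_end K w (y (r n))) \<longlonglongrightarrow> p0 \<bullet> w"
    by (simp add: p_def chord_height[OF assms(3) yw])
  have "(\<lambda>n. q (r n) \<bullet> w) \<longlonglongrightarrow> q0 \<bullet> w"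
    by (intro tendsto_intros lim_q)
  then have lim_up: "(\<lambda>n. upper_end K w (y (r n))) \<longlonglongrightarrow> q0 \<bullet> w"
    by (simp add: q_def chord_height[OF assms(3) yw])
  have "(\<lambda>n. ?f (y (r n))) \<longlonglongrightarrow> (p0 \<bullet> w + q0 \<bullet> w) / 2"
    unfolding midpoint_fun_def by (intro tendsto_intros lim_low lim_up) simp
  moreover have "(\<lambda>n. ?f (y (r n))) \<longlonglongrightarrow> M"
    using LIMSEQ_subseq_LIMSEQ[OF lim_f r(2)] by (simp add: o_def)
  ultimately have M: "M = (p0 \<bullet> w + q0 \<bullet> w) / 2"
    using LIMSEQ_unique by blast
  obtain C where C: "\<And>z. z \<in> ?S \<Longrightarrow> lower_end K w z \<le> lower_end K w ?y0 + C * norm (z - ?y0)"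
    using convex_on_segment_linear_growth[of c d "lower_end K w" ?y0]
      convex_on_lower_end[OF assms(1-3)] y0 assms(5) by auto
  have "(\<lambda>n. lower_end K w ?y0 + C * norm (y (r n) - ?y0))
      \<longlonglongrightarrow> lower_end K w ?y0 + C * norm (?y0 - ?y0)"
    by (intro tendsto_intros lim_y)
  then have "p0 \<bullet> w \<le> lower_end K w ?y0 + C * norm (?y0 - ?y0)"
    by (rule LIMSEQ_le[OF lim_low]) (use C y in blast)
  then have "p0 \<bullet> w \<le> lower_end K w ?y0"
    by simp
  moreover have "q0 \<bullet> w \<le> upper_end K w ?y0"
    using height_between_ends(2)[OF assms(1-3) \<open>q0 \<in> K\<close>] .
  ultimately have "M \<le> ?f ?y0"
    by (simp add: M midpoint_fun_def)
  moreover have "?f ?y0 \<le> M"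
    unfolding M_def by (rule cSUP_upper[OF y0 bdd])
  ultimately show ?thesis
    using y0 order_antisym unfolding M_def by blast
qed

lemma planar_shadow_is_segment:
  fixes K :: "(real ^ 'n) set" and w :: "real ^ 'n"
  assumes "compact K" "convex K" "norm w = 1" "K \<noteq> {}" "CARD('n) = 2"
  obtains c d where "shadow w K = closed_segment c d"
proof -
  have "shadow w K \<subseteq> {x. w \<bullet> x = 0}"
    using shadow_orthogonal[OF assms(3)] by (auto simp: inner_commute)
  then have "aff_dim (shadow w K) \<le> aff_dim {x. w \<bullet> x = 0}"
    by (rule aff_dim_subset)
  also have "\<dots> = 1"
    using assms(3,5) by (subst aff_dim_hyperplane) auto
  finally have "collinear (shadow w K)"
    by (simp add: collinear_aff_dim)
  moreover have "shadow w K \<noteq> {}"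
    using assms(4) by (simp add: shadow_def)
  ultimately show ?thesis
    using compact_convex_collinear_segment[OF _ compact_shadow[OF assms(1-3)] convex_shadow[OF assms(1-3)]]
      that by blast
qed

theorem theorem4p6:
  fixes K :: "(real ^ 'n) set" and w :: "real ^ 'n"
  assumes "CARD('n) \<ge> 2"
    and "convex_body K"
    and "w \<in> sphere 0 1"
  shows "bdd_above (midpoint_fun K w ` shadow w K) \<and>
    max_folding K w = (SUP y\<in>shadow w K. midpoint_fun K w y) \<and>
    (CARD('n) = 2 \<longrightarrow> (\<exists>y\<in>shadow w K. midpoint_fun K w y = max_folding K w))"
proof -
  have K: "compact K" "convex K" "K \<noteq> {}" and w: "norm w = 1"
    using assms by (auto simp: convex_body_def)
  have "\<exists>y\<in>shadow w K. midpoint_fun K w y = max_folding K w" if dim: "CARD('n) = 2"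
  proof -
    obtain c d where "shadow w K = closed_segment c d"
      using planar_shadow_is_segment[OF K(1,2) w K(3) dim] .
    then show ?thesis
      using midpoint_fun_attains_SUP[OF K(1,2) w K(3)] max_folding_eq_SUP[OF K(1,2) w K(3)]
      by simp
  qed
  then show ?thesis
    using bdd_above_midpoint_fun[OF K(1,2) w] max_folding_eq_SUP[OF K(1,2) w K(3)] by blast
qed

end
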